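(* Let $\mathbf{Y}\sim\mathcal{MMN}_p(\boldsymbol{\xi},\mathbf{\Omega},\boldsymbol{\delta};H)$, let $\mathbf{A}$ be a full-rank $p\times h$ matrix with $h\le p$, and let $\mathbf{c}\in\mathbb{R}^h$. Then $\mathbf{T}=\mathbf{c}+\mathbf{A}^\top\mathbf{Y}\sim\mathcal{MMN}_h(\boldsymbol{\xi}_{\mathbf{T}},\mathbf{\Omega}_{\mathbf{T}},\boldsymbol{\delta}_{\mathbf{T}};H)$, where $\boldsymbol{\xi}_{\mathbf{T}}=\mathbf{c}+\mathbf{A}^\top\boldsymbol{\xi}$, $\mathbf{\Omega}_{\mathbf{T}}=\mathbf{A}^\top\mathbf{\Omega}\mathbf{A}$, and $\boldsymbol{\delta}_{\mathbf{T}}=\boldsymbol{\omega}_{\mathbf{T}}^{-1}\mathbf{A}^\top\boldsymbol{\omega}\boldsymbol{\delta}$ with $\boldsymbol{\omega}_{\mathbf{T}}=(\mathbf{\Omega}_{\mathbf{T}}\odot\mathbf{I}_h)^{1/2}$.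
   Context: For $d\ge1$, $\boldsymbol{\xi}\in\mathbb{R}^d$, a $d\times d$ symmetric positive definite $\mathbf{\Omega}$, put $\boldsymbol{\omega}=(\mathbf{\Omega}\odot\mathbf{I}_d)^{1/2}=\mathrm{diag}(\mathbf{\Omega}_{11}^{1/2},\dots,\mathbf{\Omega}_{dd}^{1/2})$ ($\odot$ = Hadamard product) and $\overline{\mathbf{\Omega}}=\boldsymbol{\omega}^{-1}\mathbf{\Omega}\boldsymbol{\omega}^{-1}$; let $\boldsymbol{\delta}\in\mathbb{R}^d$ with $\overline{\mathbf{\Omega}}-\boldsymbol{\delta}\boldsymbol{\delta}^\top$ positive definite. For a real random variable $U$ with CDF $H$ and $\mathbf{Z}\sim\mathcal{N}_d(\mathbf{0},\overline{\mathbf{\Omega}}-\boldsymbol{\delta}\boldsymbol{\delta}^\top)$ independent of $U$, the law of $\boldsymbol{\xi}+\boldsymbol{\omega}(\boldsymbol{\delta}U+\mathbf{Z})$ is denoted $\mathcal{MMN}_d(\boldsymbol{\xi},\mathbf{\Omega},\boldsymbol{\delta};H)$. In the claim $\boldsymbol{\omega}$ refers to $\mathbf{\Omega}$ (dimension $p$). *)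

theory Defs
  imports "HOL-Probability.Probability"
begin

(* H is the CDF of a real random variable *)
definition is_cdf :: "(real \<Rightarrow> real) \<Rightarrow> bool" where
  "is_cdf H \<longleftrightarrow> mono H \<and> (\<forall>a. continuous (at_right a) H)
     \<and> (H \<longlongrightarrow> 0) at_bot \<and> (H \<longlongrightarrow> 1) at_top"

(* the probability law on the reals with CDF H *)
definition law_of_cdf :: "(real \<Rightarrow> real) \<Rightarrow> real measure" where
  "law_of_cdf H = interval_measure H"

definition sym_pd :: "real^'d^'d \<Rightarrow> bool" where
  "sym_pd S \<longleftrightarrow> transpose S = S \<and> (\<forall>x. x \<noteq> 0 \<longrightarrow> x \<bullet> (S *v x) > 0)"

(* omega = (Omega Hadamard I)^(1/2) *)
definition diag_sqrt :: "real^'d^'d \<Rightarrow> real^'d^'d" where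
  "diag_sqrt S = (\<chi> i j. if i = j then sqrt (S $ i $ i) else 0)"

(* Omega-bar = omega^-1 Omega omega^-1 *)
definition corr_mat :: "real^'d^'d \<Rightarrow> real^'d^'d" where
  "corr_mat S = matrix_inv (diag_sqrt S) ** S ** matrix_inv (diag_sqrt S)"

definition outer :: "real^'d \<Rightarrow> real^'d^'d" where
  "outer u = (\<chi> i j. u $ i * u $ j)"

(* multivariate normal law N_d(m, Sigma), characterised by its characteristic function *)
definition gaussian_law :: "(real^'d) measure \<Rightarrow> real^'d \<Rightarrow> real^'d^'d \<Rightarrow> bool" where
  "gaussian_law \<mu> m S \<longleftrightarrow> prob_space \<mu> \<and> sets \<mu> = sets borel \<and>
     (\<forall>t. integral\<^sup>L \<mu> (\<lambda>x. cis (t \<bullet> x))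
            = cis (t \<bullet> m) * complex_of_real (exp (- (t \<bullet> (S *v t)) / 2)))"

(* mu is the law MMN_d(xi, Omega, delta; H): law of xi + omega (delta U + Z),
   U with CDF H, Z ~ N_d(0, Omega-bar - delta delta^T), U and Z independent *)
definition MMN_law :: "(real^'d) measure \<Rightarrow> real^'d \<Rightarrow> real^'d^'d \<Rightarrow> real^'d
                       \<Rightarrow> (real \<Rightarrow> real) \<Rightarrow> bool" where
  "MMN_law \<mu> xi Om del H \<longleftrightarrow>
     sym_pd Om \<and> sym_pd (corr_mat Om - outer del) \<and> is_cdf H \<and>
     (\<exists>\<nu>. gaussian_law \<nu> 0 (corr_mat Om - outer del) \<and>
        \<mu> = distr (law_of_cdf H \<Otimes>\<^sub>M \<nu>) borel
               (\<lambda>(u, z). xi + diag_sqrt Om *v (u *\<^sub>R del + z)))"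

end

theory Submission
  imports Defs
begin

text \<open>
  Write \<open>Y = \<xi> + \<omega> (\<delta> U + Z)\<close> and let \<open>L = \<omega>\<^sub>T\<^sup>-\<^sup>1 A\<^sup>T \<omega>\<close>. Then \<open>A\<^sup>T \<omega> = \<omega>\<^sub>T L\<close>, so
  \<open>T = \<xi>\<^sub>T + \<omega>\<^sub>T (L \<delta> U + L Z)\<close>, and \<open>L Z\<close> is Gaussian, independent of \<open>U\<close>, with covariance
  \<open>L (corr_mat \<Omega> - \<delta> \<delta>\<^sup>T) L\<^sup>T\<close>. As \<open>\<omega>\<close> and \<open>\<omega>\<^sub>T\<close> are diagonal, \<open>L (corr_mat \<Omega>) L\<^sup>T =
  \<omega>\<^sub>T\<^sup>-\<^sup>1 \<Omega>\<^sub>T \<omega>\<^sub>T\<^sup>-\<^sup>1 = corr_mat \<Omega>\<^sub>T\<close>, so this covariance is \<open>corr_mat \<Omega>\<^sub>T - \<delta>\<^sub>T \<delta>\<^sub>T\<^sup>T\<close> with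
  \<open>\<delta>\<^sub>T = L \<delta>\<close>. Positive definiteness is inherited because \<open>A\<close>, and hence \<open>L\<^sup>T\<close>, is injective.
\<close>

lemma matrix_inv_right: "invertible A \<Longrightarrow> A ** matrix_inv A = mat 1"
  and matrix_inv_left: "invertible A \<Longrightarrow> matrix_inv A ** A = mat 1"
  unfolding invertible_def matrix_inv_def by (metis (mono_tags, lifting) someI_ex)+

lemma invertible_matrix_inv: "invertible A \<Longrightarrow> invertible (matrix_inv A)"
  by (metis invertible_def matrix_inv_left matrix_inv_right)

lemma matrix_inv_unique:
  assumes "A ** B = mat 1" "B ** A = mat 1"
  shows "matrix_inv A = B"
proof -
  have "invertible A" using assms invertible_def by blast
  then have "matrix_inv A = matrix_inv A ** (A ** B)" using assms by simp
  also have "\<dots> = B" using \<open>invertible A\<close> by (simp add: matrix_mul_assoc matrix_inv_left)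
  finally show ?thesis .
qed

lemma transpose_matrix_inv:
  fixes A :: "'a::comm_semiring_1^'n^'n"
  assumes "invertible A"
  shows "transpose (matrix_inv A) = matrix_inv (transpose A)"
  by (metis assms matrix_inv_left matrix_inv_right matrix_inv_unique matrix_transpose_mul transpose_mat)

lemma inj_matrix_mult:
  assumes "inj ((*v) A)" "inj ((*v) B)"
  shows "inj ((*v) (A ** B))"
proof -
  have "(*v) (A ** B) = (*v) A \<circ> (*v) B"
    by (simp add: fun_eq_iff matrix_vector_mul_assoc)
  then show ?thesis using assms by (simp add: inj_compose)
qed

lemma matrix_diff_ldistrib: "A ** (B - C) = A ** B - A ** (C :: 'a::ring_1^_^_)"
  by (vector matrix_matrix_mult_def sum_subtractf[symmetric] algebra_simps)

lemma matrix_diff_rdistrib: "(B - C) ** A = B ** A - C ** (A :: 'a::ring_1^_^_)"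
  by (vector matrix_matrix_mult_def sum_subtractf[symmetric] algebra_simps)

lemma outer_matrix_vector_mult: "outer (M *v v) = M ** outer v ** transpose M"
  by (simp add: outer_def vec_eq_iff matrix_matrix_mult_def matrix_vector_mult_def transpose_def
      sum_distrib_left sum_distrib_right mult_ac)

lemma transpose_diag_sqrt: "transpose (diag_sqrt S) = diag_sqrt S"
  by (simp add: diag_sqrt_def transpose_def vec_eq_iff)

lemma invertible_diag_sqrt:
  assumes "\<And>i. 0 < S $ i $ i"
  shows "invertible (diag_sqrt S)"
proof -
  have "det (diag_sqrt S) = (\<Prod>i\<in>UNIV. sqrt (S $ i $ i))"
    by (subst det_diagonal) (simp_all add: diag_sqrt_def)
  also have "\<dots> \<noteq> 0" using assms by (simp add: less_imp_neq[symmetric])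
  finally show ?thesis by (simp add: invertible_det_nz)
qed

lemma inner_congruence:
  fixes B :: "real^'n^'m"
  shows "x \<bullet> ((transpose B ** S ** B) *v x) = (B *v x) \<bullet> (S *v (B *v x))"
proof -
  have "x \<bullet> (transpose B *v w) = (B *v x) \<bullet> w" for w
    by (metis dot_lmul_matrix inner_commute transpose_matrix_vector)
  then show ?thesis by (simp only: matrix_vector_mul_assoc[symmetric])
qed

lemma sym_pd_diag_pos:
  assumes "sym_pd S" shows "0 < S $ i $ i"
proof -
  have "S *v axis i 1 = (\<chi> k. S $ k $ i)"
    by (simp add: matrix_vector_mult_def axis_def if_distrib[of "\<lambda>a. _ * a"] cong: if_cong)
  then have "S $ i $ i = axis i 1 \<bullet> (S *v axis i 1)"
    by (simp add: inner_axis')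
  then show ?thesis using assms unfolding sym_pd_def by (simp add: axis_eq_0_iff)
qed

lemma sym_pd_congruence:
  fixes B :: "real^'h^'p"
  assumes "sym_pd S" "inj ((*v) B)"
  shows "sym_pd (transpose B ** S ** B)"
  unfolding sym_pd_def
proof (intro conjI allI impI)
  show "transpose (transpose B ** S ** B) = transpose B ** S ** B"
    using assms(1) by (simp add: sym_pd_def matrix_transpose_mul matrix_mul_assoc)
next
  fix x :: "real^'h" assume "x \<noteq> 0"
  then have "B *v x \<noteq> 0" using assms(2) by (metis injD matrix_vector_mult_0_right)
  then show "0 < x \<bullet> ((transpose B ** S ** B) *v x)"
    using assms(1) by (simp add: inner_congruence sym_pd_def)
qed

lemma continuous_on_matrix_vector_mult [continuous_intros]:
  "continuous_on S f \<Longrightarrow> continuous_on S (\<lambda>x. (L :: real^'n^'m) *v f x)"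
  by (rule bounded_linear.continuous_on[OF matrix_vector_mul_bounded_linear])

lemma borel_measurable_matrix_vector_mult: "(*v) (L :: real^'n^'m) \<in> borel_measurable borel"
  by (intro borel_measurable_continuous_onI continuous_intros)

lemma gaussian_law_linear_image:
  assumes "gaussian_law \<nu> m S"
  shows "gaussian_law (distr \<nu> borel ((*v) L)) (L *v m) (L ** S ** transpose L)"
  unfolding gaussian_law_def
proof (intro conjI allI)
  have sets: "sets \<nu> = sets borel" and prob: "prob_space \<nu>"
    using assms by (simp_all add: gaussian_law_def)
  then have meas: "(*v) L \<in> measurable \<nu> borel"
    by (simp add: borel_measurable_matrix_vector_mult cong: measurable_cong_sets)
  then show "prob_space (distr \<nu> borel ((*v) L))"
    by (rule prob_space.prob_space_distr[OF prob])
  show "sets (distr \<nu> borel ((*v) L)) = sets borel" by simp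
  fix t
  have "integral\<^sup>L (distr \<nu> borel ((*v) L)) (\<lambda>x. cis (t \<bullet> x))
      = integral\<^sup>L \<nu> (\<lambda>z. cis ((transpose L *v t) \<bullet> z))"
    by (subst integral_distr[OF meas])
      (simp_all add: dot_lmul_matrix borel_measurable_continuous_onI continuous_intros)
  also have "\<dots> = cis ((transpose L *v t) \<bullet> m)
      * complex_of_real (exp (- ((transpose L *v t) \<bullet> (S *v (transpose L *v t))) / 2))"
    using assms unfolding gaussian_law_def by blast
  also have "\<dots> = cis (t \<bullet> (L *v m)) * complex_of_real (exp (- (t \<bullet> ((L ** S ** transpose L) *v t)) / 2))"
    using inner_congruence[of t "transpose L" S]
    by (simp only: transpose_transpose transpose_matrix_vector dot_lmul_matrix)
  finally show "integral\<^sup>L (distr \<nu> borel ((*v) L)) (\<lambda>x. cis (t \<bullet> x)) = \<dots>" .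
qed

lemma sets_law_of_cdf: "sets (law_of_cdf H) = sets borel"
  by (simp add: law_of_cdf_def)

lemma distr_pair_measure_snd:
  assumes k: "k \<in> measurable \<nu> N" and F: "F \<in> measurable (\<mu> \<Otimes>\<^sub>M N) K"
    and "sigma_finite_measure (distr \<nu> N k)"
  shows "distr (\<mu> \<Otimes>\<^sub>M \<nu>) K (\<lambda>(u, z). F (u, k z)) = distr (\<mu> \<Otimes>\<^sub>M distr \<nu> N k) K F"
proof -
  have "\<mu> \<Otimes>\<^sub>M distr \<nu> N k = distr (\<mu> \<Otimes>\<^sub>M \<nu>) (\<mu> \<Otimes>\<^sub>M N) (\<lambda>(u, z). (u, k z))"
    using pair_measure_distr[OF measurable_ident_sets[OF refl] k, of \<mu>] assms(3) by simp
  also have "distr \<dots> K F = distr (\<mu> \<Otimes>\<^sub>M \<nu>) K (F \<circ> (\<lambda>(u, z). (u, k z)))"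
    using F k by (intro distr_distr) auto
  finally show ?thesis by (simp add: comp_def case_prod_unfold)
qed

definition standardized_transform :: "real^'h^'p \<Rightarrow> real^'p^'p \<Rightarrow> real^'p^'h" where
  "standardized_transform B S =
     matrix_inv (diag_sqrt (transpose B ** S ** B)) ** transpose B ** diag_sqrt S"

lemma corr_mat_congruence:
  fixes S :: "real^'p^'p" and B :: "real^'h^'p"
  assumes "invertible (diag_sqrt S)" "invertible (diag_sqrt (transpose B ** S ** B))"
  defines "L \<equiv> standardized_transform B S"
  shows "corr_mat (transpose B ** S ** B) = L ** corr_mat S ** transpose L"
proof -
  let ?D = "diag_sqrt S" and ?DT = "diag_sqrt (transpose B ** S ** B)"
  have "transpose (matrix_inv ?D) = matrix_inv ?D"
    using assms(1) by (simp add: transpose_matrix_inv transpose_diag_sqrt)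
  moreover have "transpose (matrix_inv ?DT) = matrix_inv ?DT"
    using assms(2) by (simp add: transpose_matrix_inv transpose_diag_sqrt)
  ultimately have "L ** corr_mat S ** transpose L
      = matrix_inv ?DT ** transpose B ** (?D ** matrix_inv ?D) ** S ** (matrix_inv ?D ** ?D)
        ** B ** matrix_inv ?DT"
    by (simp add: L_def standardized_transform_def corr_mat_def matrix_transpose_mul
        transpose_diag_sqrt matrix_mul_assoc)
  also have "\<dots> = corr_mat (transpose B ** S ** B)"
    using assms(1) by (simp add: matrix_inv_left matrix_inv_right corr_mat_def matrix_mul_assoc)
  finally show ?thesis ..
qed

lemma corr_mat_diff_outer_congruence:
  fixes S :: "real^'p^'p" and B :: "real^'h^'p"
  assumes "invertible (diag_sqrt S)" "invertible (diag_sqrt (transpose B ** S ** B))"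
  defines "L \<equiv> standardized_transform B S"
  shows "corr_mat (transpose B ** S ** B) - outer (L *v d) = L ** (corr_mat S - outer d) ** transpose L"
  unfolding L_def corr_mat_congruence[OF assms(1,2)] outer_matrix_vector_mult
  by (simp only: matrix_diff_ldistrib matrix_diff_rdistrib)

lemma diag_sqrt_standardized_transform:
  assumes "invertible (diag_sqrt (transpose B ** S ** B))"
  shows "diag_sqrt (transpose B ** S ** B) *v (standardized_transform B S *v v)
    = transpose B *v (diag_sqrt S *v v)"
  using assms
  by (simp add: standardized_transform_def matrix_vector_mul_assoc matrix_mul_assoc matrix_inv_right
      del: transpose_matrix_vector)

lemma distr_affine_mmn_representation:
  fixes A :: "real^'h^'p" and Om :: "real^'p^'p" and \<mu> :: "real measure"
  assumes "sets \<mu> = sets borel" "sets \<nu> = sets borel" "prob_space \<nu>"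
    and "invertible (diag_sqrt (transpose A ** Om ** A))"
  defines "L \<equiv> standardized_transform A Om"
  shows "distr (distr (\<mu> \<Otimes>\<^sub>M \<nu>) borel (\<lambda>(u, z). xi + diag_sqrt Om *v (u *\<^sub>R del + z)))
           borel (\<lambda>y. c + transpose A *v y)
       = distr (\<mu> \<Otimes>\<^sub>M distr \<nu> borel ((*v) L)) borel
           (\<lambda>(u, z). (c + transpose A *v xi) + diag_sqrt (transpose A ** Om ** A) *v (u *\<^sub>R (L *v del) + z))"
    (is "distr (distr ?P borel ?f) borel ?g = distr ?Q borel ?F")
proof -
  have meas_L: "(*v) L \<in> measurable \<nu> borel"
    using assms(2) by (simp add: borel_measurable_matrix_vector_mult cong: measurable_cong_sets)
  have "?f \<in> borel_measurable (borel \<Otimes>\<^sub>M borel)"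
    unfolding borel_prod case_prod_unfold by (intro borel_measurable_continuous_onI continuous_intros)
  then have meas_f: "?f \<in> measurable ?P borel"
    by (simp only: measurable_cong_sets[OF sets_pair_measure_cong[OF assms(1,2)] refl])
  have "?F \<in> borel_measurable (borel \<Otimes>\<^sub>M borel)"
    unfolding borel_prod case_prod_unfold by (intro borel_measurable_continuous_onI continuous_intros)
  then have meas_F: "?F \<in> measurable (\<mu> \<Otimes>\<^sub>M borel) borel"
    by (simp only: measurable_cong_sets[OF sets_pair_measure_cong[OF assms(1) refl] refl])
  have meas_g: "?g \<in> borel_measurable borel"
    by (intro borel_measurable_continuous_onI continuous_intros)
  have "?g \<circ> ?f = (\<lambda>(u, z). ?F (u, L *v z))"
    by (simp add: fun_eq_iff L_def diag_sqrt_standardized_transform[OF assms(4)]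
        matrix_vector_right_distrib matrix_vector_mult_scaleR add.assoc del: transpose_matrix_vector)
  then have "distr (distr ?P borel ?f) borel ?g = distr ?P borel (\<lambda>(u, z). ?F (u, L *v z))"
    by (simp only: distr_distr[OF meas_g meas_f])
  also have "\<dots> = distr ?Q borel ?F"
    using prob_space.prob_space_distr[OF assms(3) meas_L]
    by (intro distr_pair_measure_snd[OF meas_L meas_F] prob_space_imp_sigma_finite)
  finally show ?thesis .
qed

lemma inj_transpose_standardized_transform:
  fixes A :: "real^'h^'p"
  assumes "inj ((*v) A)" "invertible (diag_sqrt Om)" "invertible (diag_sqrt (transpose A ** Om ** A))"
  shows "inj ((*v) (transpose (standardized_transform A Om)))"
proof -
  have "transpose (standardized_transform A Om)
      = transpose (diag_sqrt Om) ** A ** transpose (matrix_inv (diag_sqrt (transpose A ** Om ** A)))"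
    by (simp add: standardized_transform_def matrix_transpose_mul matrix_mul_assoc)
  with assms show ?thesis
    by (simp add: inj_matrix_mult inj_matrix_vector_mult transpose_invertible invertible_matrix_inv)
qed

theorem theorem4:
  fixes M :: "'s measure"
    and Y :: "'s \<Rightarrow> real^'p"
    and xi :: "real^'p" and Om :: "real^'p^'p" and del :: "real^'p"
    and H :: "real \<Rightarrow> real"
    and A :: "real^'h^'p" and c :: "real^'h"
  assumes "prob_space M"
    and "Y \<in> borel_measurable M"
    and "MMN_law (distr M borel Y) xi Om del H"
    and "CARD('h) \<le> CARD('p)"
    and "rank A = CARD('h)"
  shows "MMN_law (distr M borel (\<lambda>s. c + transpose A *v Y s))
           (c + transpose A *v xi)
           (transpose A ** Om ** A)
           (matrix_inv (diag_sqrt (transpose A ** Om ** A)) *v (transpose A *v (diag_sqrt Om *v del)))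
           H"
proof -
  let ?OmT = "transpose A ** Om ** A"
  define L where "L = standardized_transform A Om"
  from assms(3) obtain \<nu> where pdOm: "sym_pd Om" and pdS: "sym_pd (corr_mat Om - outer del)"
    and cdf: "is_cdf H" and gauss: "gaussian_law \<nu> 0 (corr_mat Om - outer del)"
    and lawY: "distr M borel Y = distr (law_of_cdf H \<Otimes>\<^sub>M \<nu>) borel
                 (\<lambda>(u, z). xi + diag_sqrt Om *v (u *\<^sub>R del + z))"
    unfolding MMN_law_def by blast
  \<comment> \<open>The hypothesis \<open>CARD('h) \<le> CARD('p)\<close> is implied by the rank condition.\<close>
  have injA: "inj ((*v) A)" using assms(5) full_rank_injective by blast
  have pdOmT: "sym_pd ?OmT" using pdOm injA by (rule sym_pd_congruence)
  have invD: "invertible (diag_sqrt Om)" and invDT: "invertible (diag_sqrt ?OmT)"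
    using pdOm pdOmT by (simp_all add: invertible_diag_sqrt sym_pd_diag_pos)
  have delT: "matrix_inv (diag_sqrt ?OmT) *v (transpose A *v (diag_sqrt Om *v del)) = L *v del"
    unfolding L_def standardized_transform_def by (simp only: matrix_vector_mul_assoc matrix_mul_assoc)
  have pdST: "sym_pd (L ** (corr_mat Om - outer del) ** transpose L)"
    using sym_pd_congruence[OF pdS inj_transpose_standardized_transform[OF injA invD invDT]]
    by (simp only: L_def transpose_transpose)
  have "(\<lambda>y. c + transpose A *v y) \<in> borel_measurable borel"
    by (intro borel_measurable_continuous_onI continuous_intros)
  then have "distr M borel (\<lambda>s. c + transpose A *v Y s)
      = distr (distr M borel Y) borel (\<lambda>y. c + transpose A *v y)"
    using assms(2) by (simp only: distr_distr comp_def)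
  also have "\<dots> = distr (law_of_cdf H \<Otimes>\<^sub>M distr \<nu> borel ((*v) L)) borel
      (\<lambda>(u, z). (c + transpose A *v xi) + diag_sqrt ?OmT *v (u *\<^sub>R (L *v del) + z))"
    using gauss unfolding lawY L_def gaussian_law_def
    by (intro distr_affine_mmn_representation[OF sets_law_of_cdf _ _ invDT]) simp_all
  finally show ?thesis
    unfolding MMN_law_def delT corr_mat_diff_outer_congruence[OF invD invDT, folded L_def]
    using pdOmT pdST cdf gaussian_law_linear_image[OF gauss, of L] by auto
qed

end
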